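(* Let $b_1,b_2,b_3,\sigma_1,\sigma_2,f_1,f_2,f_3,h\in\mathbb R$ be constants (the coefficients of a linear FBSDE with constant coefficients and $\sigma_3=0$), and let $$F(y)=f_1+[f_2+b_1+\sigma_1f_3]\,y+[b_2+f_3\sigma_2+b_3\sigma_1]\,y^2+\sigma_2b_3\,y^3.$$ Then the dominating ODE $$\mathbf y_t=h+\int_t^TF(\mathbf y_s)\,ds,\qquad t\in[0,T],$$ has a bounded solution for arbitrary $T>0$ if and only if one of the following three cases holds true: (i) $F(h)\ge0$ and $F$ has a zero point in $[h,\infty)$; (ii) $F(h)\le0$ and $F$ has a zero point in $(-\infty,h]$; (iii) $\sigma_2b_3=0$ and $b_2+f_3\sigma_2+b_3\sigma_1=0$.
   Context: The linear FBSDE in question is $\mathcal X_t=1+\int_0^t(b_1\mathcal X_s+b_2\mathcal Y_s+b_3\mathcal Z_s)ds+\int_0^t(\sigma_1\mathcal X_s+\sigma_2\mathcal Y_s+\sigma_3\mathcal Z_s)dB_s$, $\mathcal Y_t=h\mathcal X_T+\int_t^T(f_1\mathcal X_s+f_2\mathcal Y_s+f_3\mathcal Z_s)ds-\int_t^T\mathcal Z_sdB_s$, with $\sigma_3=0$; it serves only as motivation for the ODE, and the claim concerns the deterministic ODE alone. "For arbitrary $T$" means: for every $T>0$ there is a bounded solution on $[0,T]$. *)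

theory Defs
  imports "HOL-Analysis.Analysis"
begin

definition dominating_F ::
  "real \<Rightarrow> real \<Rightarrow> real \<Rightarrow> real \<Rightarrow> real \<Rightarrow> real \<Rightarrow> real \<Rightarrow> real \<Rightarrow> real \<Rightarrow> real" where
  "dominating_F b1 b2 b3 \<sigma>1 \<sigma>2 f1 f2 f3 y =
     f1 + (f2 + b1 + \<sigma>1 * f3) * y + (b2 + f3 * \<sigma>2 + b3 * \<sigma>1) * y\<^sup>2 + \<sigma>2 * b3 * y ^ 3"

text \<open>
  The integrability clause is needed because \<^const>\<open>integral\<close> takes the value 0 on
  non-integrable functions.
\<close>

definition solves_dominating_ODE ::
  "(real \<Rightarrow> real) \<Rightarrow> real \<Rightarrow> real \<Rightarrow> (real \<Rightarrow> real) \<Rightarrow> bool" where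
  "solves_dominating_ODE F h T y \<longleftrightarrow>
     (\<forall>t\<in>{0..T}. (\<lambda>s. F (y s)) integrable_on {t..T} \<and>
                 y t = h + integral {t..T} (\<lambda>s. F (y s)))"

end

theory Submission
  imports Defs "HOL-Real_Asymp.Real_Asymp"
begin

text \<open>
  In reversed time the equation is the autonomous problem \<open>u' = F u\<close>, \<open>u 0 = h\<close>. If \<open>F h > 0\<close> and
  \<open>z\<close> is the first zero of \<open>F\<close> above \<open>h\<close>, then \<open>F\<close> vanishes at least linearly at \<open>z\<close>, so the travel
  time \<open>\<integral> 1 / F\<close> from \<open>h\<close> to \<open>z\<close> is infinite, and its inverse is a solution for all times. If there
  is no such zero and \<open>F\<close> is not affine, then \<open>F x \<ge> c * (1 + x\<^sup>2)\<close> on \<open>[h, \<infinity>)\<close> for some \<open>c > 0\<close>, so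
  \<open>arctan u\<close> grows at rate at least \<open>c\<close>, which bounds the lifespan by \<open>pi / c\<close>. The case \<open>F h < 0\<close>
  follows by the reflection \<open>x \<mapsto> - x\<close>.
\<close>

text \<open>The level set is compact and so has a least element. It supplies both the first zero of
  \<open>F\<close> above \<open>h\<close> and the first time a solution takes its terminal
  value.\<close>

lemma first_point_attaining_value:
  fixes f :: "real \<Rightarrow> real"
  assumes "continuous_on {a..b} f" "a \<le> b" "f b = c"
  obtains s where "s \<in> {a..b}" "f s = c" "\<And>r. r \<in> {a..b} \<Longrightarrow> f r = c \<Longrightarrow> s \<le> r"
proof -
  let ?S = "{x \<in> {a..b}. f x = c}"
  have "closed ?S"
    by (rule continuous_closed_preimage_constant[OF assms(1)]) simp
  moreover have "bounded ?S"
    by (rule bounded_subset[OF bounded_closed_interval]) auto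
  ultimately have "compact ?S" by (simp add: compact_eq_bounded_closed)
  moreover have "?S \<noteq> {}" using assms by auto
  ultimately obtain s where "s \<in> ?S" "\<forall>r\<in>?S. s \<le> r"
    by (elim compact_attains_inf[THEN bexE]) blast
  then show thesis by (intro that[of s]) simp_all
qed

section \<open>Integral equation versus differential equation\<close>

lemma solves_dominating_ODE_if_derivative:
  assumes cont: "continuous_on {0..T} y" and yT: "y T = h"
    and deriv: "\<And>t. t \<in> {0<..<T} \<Longrightarrow> (y has_real_derivative - F (y t)) (at t)"
  shows "solves_dominating_ODE F h T y"
  unfolding solves_dominating_ODE_def
proof
  fix t assume t: "t \<in> {0..T}"
  have "((\<lambda>s. - F (y s)) has_integral y T - y t) {t..T}"
  proof (rule fundamental_theorem_of_calculus_interior)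
    show "continuous_on {t..T} y"
      by (rule continuous_on_subset[OF cont]) (use t in auto)
    show "(y has_vector_derivative - F (y s)) (at s)" if "s \<in> {t<..<T}" for s
      using deriv[of s] that t by (simp add: has_real_derivative_iff_has_vector_derivative)
  qed (use t in auto)
  from has_integral_neg[OF this] have "((\<lambda>s. F (y s)) has_integral y t - h) {t..T}"
    by (simp add: yT)
  then show "(\<lambda>s. F (y s)) integrable_on {t..T} \<and> y t = h + integral {t..T} (\<lambda>s. F (y s))"
    by (auto simp: integral_unique)
qed

text \<open>First half of a regularity bootstrap: a solution is only assumed to make
  \<open>F (y s)\<close> integrable, but an indefinite integral is continuous.\<close>

lemma solves_dominating_ODE_continuous_on:
  assumes "solves_dominating_ODE F h T y" "T > 0"
  shows "continuous_on {0..T} y"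
proof -
  have "continuous_on {0..T} (\<lambda>t. h + integral {t..T} (\<lambda>s. F (y s)))"
    using assms unfolding solves_dominating_ODE_def
    by (intro continuous_intros indefinite_integral_continuous_1') auto
  then show ?thesis
    using assms(1) unfolding solves_dominating_ODE_def
    by (subst continuous_on_cong[OF refl]) auto
qed

text \<open>Second half of the bootstrap: once \<open>y\<close> is continuous, so is the integrand,
  and the fundamental theorem of calculus applies. The minus sign arises because the variable is the
  lower limit of integration.\<close>

lemma solves_dominating_ODE_derivative:
  assumes sol: "solves_dominating_ODE F h T y" and "T > 0"
    and F: "continuous_on UNIV F" and t: "t \<in> {0..T}"
  shows "(y has_real_derivative - F (y t)) (at t within {0..T})"
proof -
  have cont: "continuous_on {0..T} (\<lambda>s. F (y s))"
    using continuous_on_compose2[OF F solves_dominating_ODE_continuous_on[OF sol \<open>T > 0\<close>]] by simp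
  let ?G = "\<lambda>t. integral {0..t} (\<lambda>s. F (y s))"
  have y: "y s = y 0 - ?G s" if "s \<in> {0..T}" for s
  proof -
    have "?G s + integral {s..T} (\<lambda>s. F (y s)) = ?G T"
      using that cont by (intro Henstock_Kurzweil_Integration.integral_combine
          integrable_continuous_interval) auto
    moreover have "y s = h + integral {s..T} (\<lambda>s. F (y s))" "y 0 = h + ?G T"
      using sol that \<open>T > 0\<close> unfolding solves_dominating_ODE_def by auto
    ultimately show ?thesis by simp
  qed
  have "((\<lambda>s. y 0 - ?G s) has_real_derivative - F (y t)) (at t within {0..T})"
    using integral_has_real_derivative[OF cont t] by (auto intro!: derivative_eq_intros)
  then show ?thesis
    by (rule has_field_derivative_transform_within[OF _ zero_less_one t]) (rule y[symmetric])
qed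

section \<open>Reflection of the state space\<close>

lemma solves_dominating_ODE_reflect:
  assumes "solves_dominating_ODE F h T y"
  shows "solves_dominating_ODE (\<lambda>x. - F (- x)) (- h) T (\<lambda>t. - y t)"
  unfolding solves_dominating_ODE_def
proof
  fix t assume t: "t \<in> {0..T}"
  have "(\<lambda>s. F (y s)) integrable_on {t..T}" "y t = h + integral {t..T} (\<lambda>s. F (y s))"
    using assms t unfolding solves_dominating_ODE_def by blast+
  then show "(\<lambda>s. - F (- (- y s))) integrable_on {t..T} \<and>
      - y t = - h + integral {t..T} (\<lambda>s. - F (- (- y s)))"
    using integrable_neg[of "\<lambda>s. F (y s)" "{t..T}"] by simp
qed

lemma solvable_reflect_iff:
  "(\<exists>y. solves_dominating_ODE (\<lambda>x. - F (- x)) (- h) T y \<and> bounded (y ` {0..T})) \<longleftrightarrow>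
   (\<exists>y. solves_dominating_ODE F h T y \<and> bounded (y ` {0..T}))" (is "?L \<longleftrightarrow> ?R")
proof
  assume ?L
  then obtain y where y: "solves_dominating_ODE (\<lambda>x. - F (- x)) (- h) T y" "bounded (y ` {0..T})"
    by blast
  from solves_dominating_ODE_reflect[OF y(1)] have "solves_dominating_ODE F h T (\<lambda>t. - y t)" by simp
  moreover have "bounded ((\<lambda>t. - y t) ` {0..T})"
    using y(2) by (simp add: bounded_iff)
  ultimately show ?R by blast
next
  assume ?R
  then obtain y where y: "solves_dominating_ODE F h T y" "bounded (y ` {0..T})"
    by blast
  from solves_dominating_ODE_reflect[OF y(1)]
  have "solves_dominating_ODE (\<lambda>x. - F (- x)) (- h) T (\<lambda>t. - y t)" .
  moreover have "bounded ((\<lambda>t. - y t) ` {0..T})"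
    using y(2) by (simp add: bounded_iff)
  ultimately show ?L by blast
qed

section \<open>Existence for every horizon\<close>

lemma solvable_if_derivative:
  assumes "continuous_on {0..T} y" and "y T = h"
    and "\<And>t. t \<in> {0<..<T} \<Longrightarrow> (y has_real_derivative - F (y t)) (at t)"
  shows "\<exists>y. solves_dominating_ODE F h T y \<and> bounded (y ` {0..T})"
proof (intro exI conjI)
  show "solves_dominating_ODE F h T y"
    using assms by (rule solves_dominating_ODE_if_derivative)
  show "bounded (y ` {0..T})"
    by (intro compact_imp_bounded compact_continuous_image assms(1) compact_Icc)
qed

lemma solvable_if_affine:
  fixes a b :: real
  assumes F: "\<And>x. F x = a + b * x"
  shows "\<exists>y. solves_dominating_ODE F h T y \<and> bounded (y ` {0..T})"
proof (cases "b = 0")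
  case True
  show ?thesis
    by (rule solvable_if_derivative[where y = "\<lambda>t. h + a * (T - t)"])
      (auto simp: F True intro!: continuous_intros derivative_eq_intros)
next
  case False
  show ?thesis
    \<comment> \<open>The deviation from the equilibrium \<open>- a / b\<close> grows like
      \<open>exp (b * t)\<close> in reversed time.\<close>
    by (rule solvable_if_derivative[where y = "\<lambda>t. (h + a / b) * exp (b * (T - t)) - a / b"])
      (use False in \<open>auto simp: F field_simps intro!: continuous_intros derivative_eq_intros\<close>)
qed

text \<open>Separation of variables: \<open>\<Phi> x\<close> is the time needed to travel from
  \<open>h\<close> to \<open>x\<close>. The linear bound makes \<open>1 / F\<close> at least
  \<open>1 / (L * (z - x))\<close>, whose integral diverges logarithmically at \<open>z\<close>.
  Stopping at some \<open>v < z\<close> avoids the singularity while the travel time still exceeds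
  \<open>T\<close>.\<close>

lemma solvable_if_linear_approach:
  assumes "T > 0" and hz: "h < z" and F: "continuous_on {h..z} F"
    and pos: "\<And>x. h \<le> x \<Longrightarrow> x < z \<Longrightarrow> F x > 0"
    and L: "\<And>x. h \<le> x \<Longrightarrow> x \<le> z \<Longrightarrow> F x \<le> L * (z - x)"
  shows "\<exists>y. solves_dominating_ODE F h T y \<and> bounded (y ` {0..T})"
proof -
  define \<Phi> where "\<Phi> x = integral {h..x} (\<lambda>s. 1 / F s)" for x
  have "L * (z - h) > 0" using L[of h] pos[of h] hz by auto
  with hz have "L > 0" by (simp add: zero_less_mult_iff)
  \<comment> \<open>The point that the comparison flow \<open>u' = L * (z - u)\<close>, started at
    \<open>h\<close>, reaches at time \<open>T + 1\<close>.\<close>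
  define v where "v = z - (z - h) * exp (- (L * (T + 1)))"
  have "(z - h) * exp (- (L * (T + 1))) < (z - h) * 1"
    using hz \<open>L > 0\<close> \<open>T > 0\<close> by (intro mult_strict_left_mono) auto
  moreover have "(z - h) * exp (- (L * (T + 1))) > 0"
    using hz by simp
  ultimately have v: "h < v" "v < z"
    by (auto simp: v_def)
  have cont: "continuous_on {h..v} (\<lambda>s. 1 / F s)"
    using v pos by (intro continuous_intros continuous_on_subset[OF F]) (force simp: less_le)+
  have \<Phi>': "(\<Phi> has_real_derivative 1 / F x) (at x within {h..v})" if "x \<in> {h..v}" for x
    unfolding \<Phi>_def by (rule integral_has_real_derivative[OF cont that])
  have \<Phi>'': "(\<Phi> has_real_derivative 1 / F x) (at x)" if "x \<in> {h<..<v}" for x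
    using \<Phi>'[of x] that by (auto simp: at_within_Icc_at)
  have \<Phi>_cont: "continuous_on {h..v} \<Phi>"
    by (rule DERIV_continuous_on[OF \<Phi>'])
  have \<Phi>h: "\<Phi> h = 0" by (simp add: \<Phi>_def)
  have mono: "\<Phi> x < \<Phi> w" if "h \<le> x" "x < w" "w \<le> v" for x w
  proof (rule DERIV_pos_imp_increasing_open[OF \<open>x < w\<close>])
    show "\<exists>d. (\<Phi> has_real_derivative d) (at r) \<and> 0 < d" if "x < r" "r < w" for r
      using \<Phi>''[of r] pos[of r] that \<open>h \<le> x\<close> \<open>w \<le> v\<close> v by (intro exI[of _ "1 / F r"]) auto
    show "continuous_on {x..w} \<Phi>"
      by (rule continuous_on_subset[OF \<Phi>_cont]) (use that in auto)
  qed
  have "\<Phi> v > T"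
  proof -
    \<comment> \<open>Travel time under \<open>F\<close> minus that under the comparison flow, up to
      a constant. It is nondecreasing, and comparing its values at \<open>h\<close> and
      \<open>v\<close> gives \<open>\<Phi> v \<ge> T + 1\<close>.\<close>
    let ?g = "\<lambda>x. \<Phi> x + ln (z - x) / L"
    have "?g h \<le> ?g v"
    proof (rule DERIV_nonneg_imp_increasing_open[where f = ?g])
      show "\<exists>d. (?g has_real_derivative d) (at x) \<and> 0 \<le> d" if "h < x" "x < v" for x
      proof (intro exI conjI)
        show "(?g has_real_derivative 1 / F x - 1 / (z - x) / L) (at x)"
          using that v \<open>L > 0\<close> by (auto intro!: derivative_eq_intros \<Phi>'')
        have "F x \<le> L * (z - x)" "F x > 0" using L pos that v by auto
        then show "0 \<le> 1 / F x - 1 / (z - x) / L"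
          using that v \<open>L > 0\<close> by (simp add: divide_simps mult.commute)
      qed
      show "continuous_on {h..v} ?g"
        using v \<open>L > 0\<close> by (intro continuous_intros \<Phi>_cont) auto
    qed (use v in auto)
    moreover have "ln (z - v) = ln (z - h) - L * (T + 1)"
      using hz by (simp add: v_def ln_mult)
    ultimately have "L * (T + 1) \<le> L * \<Phi> v"
      using \<Phi>h \<open>L > 0\<close> by (simp add: field_simps)
    then show ?thesis
      using \<open>L > 0\<close> by simp
  qed
  define u where "u = the_inv_into {h..v} \<Phi>"
  have inj: "inj_on \<Phi> {h..v}"
    by (rule linorder_inj_onI) (use mono in force)+
  have im: "\<Phi> ` {h..v} = {0..\<Phi> v}"
  proof
    show "\<Phi> ` {h..v} \<subseteq> {0..\<Phi> v}"
      using mono \<Phi>h v by (force simp: le_less)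
    show "{0..\<Phi> v} \<subseteq> \<Phi> ` {h..v}"
      using IVT'[of \<Phi> h _ v] \<Phi>h \<Phi>_cont v by force
  qed
  have u\<Phi>: "u (\<Phi> x) = x" if "x \<in> {h..v}" for x
    unfolding u_def by (rule the_inv_into_f_f[OF inj that])
  have \<Phi>u: "\<Phi> (u t) = t" "u t \<in> {h..v}" if "t \<in> {0..\<Phi> v}" for t
    using that u\<Phi> unfolding im[symmetric] by auto
  have u_cont: "continuous_on {0..\<Phi> v} u"
    using continuous_on_inv[OF \<Phi>_cont compact_Icc] u\<Phi> unfolding im[symmetric] by blast
  have u': "(u has_real_derivative F (u t)) (at t)" if "t \<in> {0<..<\<Phi> v}" for t
  proof -
    \<comment> \<open>At the endpoints \<open>\<Phi>\<close> takes the values \<open>0\<close> and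
      \<open>\<Phi> v\<close>, which an interior time avoids; hence the two-sided derivative of
      \<open>\<Phi>\<close> is available at \<open>u t\<close>.\<close>
    have "u t \<noteq> h" "u t \<noteq> v" using \<Phi>u[of t] \<Phi>h that by auto
    then have ut: "u t \<in> {h<..<v}" using \<Phi>u(2)[of t] that by auto
    have "(u has_real_derivative inverse (1 / F (u t))) (at t)"
    proof (rule DERIV_inverse_function[where a = 0 and b = "\<Phi> v" and f = \<Phi>])
      show "isCont u t"
        using continuous_on_interior[OF u_cont] that by simp
      show "1 / F (u t) \<noteq> 0" using pos[of "u t"] ut v by auto
    qed (use \<Phi>''[OF ut] that \<Phi>u in auto)
    then show ?thesis by simp
  qed
  show ?thesis
  proof (rule solvable_if_derivative)
    \<comment> \<open>Reversing time turns the initial value problem for \<open>u\<close> into the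
      terminal value problem.\<close>
    show "continuous_on {0..T} (\<lambda>t. u (T - t))"
      using \<open>\<Phi> v > T\<close> by (intro continuous_on_compose2[OF u_cont] continuous_intros) auto
    show "u (T - T) = h" using u\<Phi>[of h] \<Phi>h v by simp
    show "((\<lambda>t. u (T - t)) has_real_derivative - F (u (T - t))) (at t)" if "t \<in> {0<..<T}" for t
    proof -
      have "((-) T has_real_derivative - 1) (at t)"
        by (auto intro!: derivative_eq_intros)
      moreover have "(u has_real_derivative F (u (T - t))) (at (T - t))"
        using that \<open>\<Phi> v > T\<close> by (intro u') auto
      ultimately show ?thesis
        using DERIV_chain2[of u _ "(-) T" t "- 1"] by simp
    qed
  qed
qed

lemma solvable_if_zero_above:
  fixes a0 a1 a2 a3 :: real
  assumes F: "\<And>x. F x = a0 + a1 * x + a2 * x\<^sup>2 + a3 * x ^ 3"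
    and "T > 0" "F h \<ge> 0" and z0: "h \<le> z0" "F z0 = 0"
  shows "\<exists>y. solves_dominating_ODE F h T y \<and> bounded (y ` {0..T})"
proof (cases "F h = 0")
  case True
  show ?thesis
    by (rule solvable_if_derivative[where y = "\<lambda>_. h"]) (auto simp: True)
next
  case False
  have F_cont: "continuous_on S F" for S
    unfolding F[abs_def] by (intro continuous_intros)
  obtain z where z: "z \<in> {h..z0}" "F z = 0"
    and least: "\<And>x. x \<in> {h..z0} \<Longrightarrow> F x = 0 \<Longrightarrow> z \<le> x"
    using first_point_attaining_value[OF F_cont z0] by blast
  \<comment> \<open>A nonpositive value before \<open>z\<close> would produce, by the intermediate
    value theorem, a zero smaller than \<open>z\<close>.\<close>
  have pos: "F x > 0" if x: "h \<le> x" "x < z" for x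
  proof (rule ccontr)
    assume "\<not> F x > 0"
    then obtain w where "h \<le> w" "w \<le> x" "F w = 0"
      using IVT2'[of F x 0 h] F_cont x \<open>F h \<ge> 0\<close> by auto
    with least[of w] x z show False by auto
  qed
  \<comment> \<open>The quotient of \<open>F x - F z\<close> by \<open>z - x\<close>. Being a
    polynomial, it is bounded on the compact interval, and any upper bound serves as
    \<open>L\<close>.\<close>
  let ?Q = "\<lambda>x. - (a1 + a2 * (x + z) + a3 * (x\<^sup>2 + x * z + z\<^sup>2))"
  have "compact (?Q ` {h..z})"
    by (intro compact_continuous_image continuous_intros) auto
  then obtain L where L: "\<And>x. x \<in> {h..z} \<Longrightarrow> ?Q x \<le> L"
    using bounded_imp_bdd_above[OF compact_imp_bounded] unfolding bdd_above_def by fast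
  show ?thesis
  proof (rule solvable_if_linear_approach[OF \<open>T > 0\<close> _ F_cont pos])
    show "h < z" using z False by (auto simp: less_le)
    show "F x \<le> L * (z - x)" if "h \<le> x" "x \<le> z" for x
    proof -
      have "F x = F x - F z" using z by simp
      also have "\<dots> = ?Q x * (z - x)"
        by (simp add: F algebra_simps power2_eq_square power3_eq_cube)
      also have "\<dots> \<le> L * (z - x)"
        using L that by (intro mult_right_mono) auto
      finally show ?thesis .
    qed
  qed auto
qed

section \<open>Finite lifespan in the absence of a zero\<close>

text \<open>Positivity near infinity forces a positive leading coefficient, and the degree is at
  least two, so the ratio of \<open>F x\<close> to \<open>1 + x\<^sup>2\<close> is eventually
  bounded away from zero. On the remaining compact interval it attains a positive minimum.\<close>

lemma positive_polynomial_quadratic_growth: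
  fixes a0 a1 a2 a3 :: real
  assumes F: "\<And>x. F x = a0 + a1 * x + a2 * x\<^sup>2 + a3 * x ^ 3"
    and pos: "\<And>x. x \<ge> h \<Longrightarrow> F x > 0" and nonaffine: "\<not> (a3 = 0 \<and> a2 = 0)"
  obtains c where "c > 0" "\<And>x. x \<ge> h \<Longrightarrow> F x \<ge> c * (1 + x\<^sup>2)"
proof -
  have ev_pos: "eventually (\<lambda>x. a0 + a1 * x + a2 * x\<^sup>2 + a3 * x ^ 3 > 0) at_top"
    using eventually_ge_at_top[of h] by eventually_elim (use pos F in auto)
  have "\<exists>c>0. eventually (\<lambda>x. F x / (1 + x\<^sup>2) \<ge> c) at_top"
  proof (cases "a3 = 0")
    case True
    have "a2 > 0"
    proof (rule ccontr)
      assume "\<not> a2 > 0"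
      then have "a2 < 0" using nonaffine True by auto
      then have "eventually (\<lambda>x. a0 + a1 * x + a2 * x\<^sup>2 < 0) at_top"
        by real_asymp
      with ev_pos have "eventually (\<lambda>x::real. False) at_top"
        by eventually_elim (use True in auto)
      then show False by simp
    qed
    then have "((\<lambda>x. (a0 + a1 * x + a2 * x\<^sup>2) / (1 + x\<^sup>2)) \<longlongrightarrow> a2) at_top"
      by real_asymp
    then have "eventually (\<lambda>x. (a0 + a1 * x + a2 * x\<^sup>2) / (1 + x\<^sup>2) > a2 / 2) at_top"
      by (rule order_tendstoD) (use \<open>a2 > 0\<close> in simp)
    then have "eventually (\<lambda>x. F x / (1 + x\<^sup>2) \<ge> a2 / 2) at_top"
      by eventually_elim (use True in \<open>simp add: F\<close>)
    with \<open>a2 > 0\<close> show ?thesis by (intro exI[of _ "a2 / 2"]) auto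
  next
    case False
    have "a3 > 0"
    proof (rule ccontr)
      assume "\<not> a3 > 0"
      then have "a3 < 0" using False by auto
      then have "eventually (\<lambda>x. a0 + a1 * x + a2 * x\<^sup>2 + a3 * x ^ 3 < 0) at_top"
        by real_asymp
      with ev_pos have "eventually (\<lambda>x::real. False) at_top"
        by eventually_elim auto
      then show False by simp
    qed
    then have "filterlim (\<lambda>x. (a0 + a1 * x + a2 * x\<^sup>2 + a3 * x ^ 3) / (1 + x\<^sup>2)) at_top at_top"
      by real_asymp
    then have "eventually (\<lambda>x. F x / (1 + x\<^sup>2) \<ge> 1) at_top"
      by (simp add: filterlim_at_top F[abs_def])
    then show ?thesis by (intro exI[of _ 1]) auto
  qed
  then obtain c N where c: "c > 0" "\<And>x. x \<ge> N \<Longrightarrow> F x / (1 + x\<^sup>2) \<ge> c"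
    unfolding eventually_at_top_linorder by blast
  have denom: "1 + x\<^sup>2 > 0" for x :: real
    by (simp add: add_pos_nonneg)
  \<comment> \<open>Taking \<open>max h N\<close> keeps the interval nonempty when
    \<open>N < h\<close>.\<close>
  have cont: "continuous_on {h..max h N} (\<lambda>x. F x / (1 + x\<^sup>2))"
    unfolding F[abs_def] using denom by (intro continuous_intros) (auto simp: less_imp_neq[symmetric])
  obtain m where m: "m \<in> {h..max h N}"
    "\<And>x. x \<in> {h..max h N} \<Longrightarrow> F m / (1 + m\<^sup>2) \<le> F x / (1 + x\<^sup>2)"
    using continuous_attains_inf[OF compact_Icc _ cont] by auto
  show thesis
  proof
    show "min c (F m / (1 + m\<^sup>2)) > 0" using c(1) pos[of m] m(1) denom[of m] by simp
    show "F x \<ge> min c (F m / (1 + m\<^sup>2)) * (1 + x\<^sup>2)" if "x \<ge> h" for x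
    proof -
      have "min c (F m / (1 + m\<^sup>2)) \<le> F x / (1 + x\<^sup>2)"
        using c(2)[of x] m(2)[of x] that by (cases "x \<ge> N") auto
      then show ?thesis using denom[of x] by (simp add: pos_le_divide_eq)
    qed
  qed
qed

text \<open>Whenever \<open>y\<close> equals \<open>h\<close> its slope is \<open>- F h < 0\<close>,
  so the level \<open>h\<close> can only be crossed downwards in forward time. A solution below
  \<open>h\<close> could therefore never climb back to its terminal value. This confines solutions
  to the region where the growth bound on \<open>F\<close> holds.\<close>

lemma solves_dominating_ODE_ge_terminal:
  assumes sol: "solves_dominating_ODE F h T y" and "T > 0"
    and F: "continuous_on UNIV F" and "F h > 0" and t: "t \<in> {0..T}"
  shows "y t \<ge> h"
proof (rule ccontr)
  assume less: "\<not> y t \<ge> h"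
  have y_cont: "continuous_on {t..T} y"
    by (rule continuous_on_subset[OF solves_dominating_ODE_continuous_on[OF sol \<open>T > 0\<close>]])
      (use t in auto)
  have yT: "y T = h" using sol \<open>T > 0\<close> unfolding solves_dominating_ODE_def by auto
  have "t \<le> T" using t by simp
  obtain s where s: "s \<in> {t..T}" "y s = h"
    and least: "\<And>r. r \<in> {t..T} \<Longrightarrow> y r = h \<Longrightarrow> s \<le> r"
    using first_point_attaining_value[OF y_cont \<open>t \<le> T\<close> yT] by blast
  have "t < s" using s less by (auto simp: less_le)
  have "(y has_real_derivative - F (y s)) (at s within {0..T})"
    using solves_dominating_ODE_derivative[OF sol \<open>T > 0\<close> F] s t by auto
  from has_real_derivative_neg_dec_left[OF this] obtain d where d: "d > 0"
    "\<And>e. e > 0 \<Longrightarrow> s - e \<in> {0..T} \<Longrightarrow> e < d \<Longrightarrow> y s < y (s - e)"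
    using s \<open>F h > 0\<close> by auto
  \<comment> \<open>Small enough for the strict decrease at \<open>s\<close> to apply, yet with
    \<open>s - e\<close> not before \<open>t\<close>. Then \<open>y\<close> passes from below
    \<open>h\<close> at \<open>t\<close> to above \<open>h\<close> at \<open>s - e\<close>, hitting
    \<open>h\<close> before the first time \<open>s\<close>.\<close>
  define e where "e = min (d / 2) (s - t)"
  have e: "e > 0" "e < d" "e \<le> s - t"
    using d(1) \<open>t < s\<close> by (auto simp: e_def)
  have "y (s - e) > h" using d(2)[of e] e s t by auto
  moreover have "continuous_on {t..s - e} y"
    by (rule continuous_on_subset[OF y_cont]) (use e s in auto)
  ultimately obtain r where "t \<le> r" "r \<le> s - e" "y r = h"
    using IVT'[of y t h "s - e"] less e by auto
  with least[of r] e s show False by auto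
qed

text \<open>The bound \<open>c * (1 + x\<^sup>2)\<close> matches the derivative of
  \<open>arctan\<close>, so \<open>arctan (y t)\<close> falls at rate at least \<open>c\<close> in
  forward time. This excludes every solution on a long horizon, bounded or not.\<close>

lemma not_solvable_if_no_zero_above:
  fixes a0 a1 a2 a3 :: real
  assumes F: "\<And>x. F x = a0 + a1 * x + a2 * x\<^sup>2 + a3 * x ^ 3"
    and "F h > 0" and nz: "\<And>x. x \<ge> h \<Longrightarrow> F x \<noteq> 0" and nonaffine: "\<not> (a3 = 0 \<and> a2 = 0)"
  obtains T where "T > 0" "\<And>y. \<not> solves_dominating_ODE F h T y"
proof -
  have F_cont: "continuous_on S F" for S
    unfolding F[abs_def] by (intro continuous_intros)
  have pos: "F x > 0" if x: "x \<ge> h" for x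
  proof (rule ccontr)
    assume "\<not> F x > 0"
    then obtain w where "h \<le> w" "F w = 0"
      using IVT2'[of F x 0 h] F_cont x \<open>F h > 0\<close> by auto
    with nz show False by auto
  qed
  obtain c where c: "c > 0" "\<And>x. x \<ge> h \<Longrightarrow> F x \<ge> c * (1 + x\<^sup>2)"
    using positive_polynomial_quadratic_growth[of F, OF F pos nonaffine] by blast
  \<comment> \<open>Over this horizon \<open>arctan (y t)\<close> would have to fall by at least
    \<open>pi\<close>, but its values lie strictly between \<open>- pi / 2\<close> and
    \<open>pi / 2\<close>.\<close>
  define T where "T = pi / c"
  have "T > 0" using c by (simp add: T_def)
  have "\<not> solves_dominating_ODE F h T y" for y
  proof
    assume sol: "solves_dominating_ODE F h T y"
    let ?g = "\<lambda>t. arctan (y t) + c * t"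
    have "?g T \<le> ?g 0"
    proof (rule DERIV_nonpos_imp_decreasing_open[where f = ?g])
      show "\<exists>d. (?g has_real_derivative d) (at t) \<and> d \<le> 0" if t: "0 < t" "t < T" for t
      proof (intro exI conjI)
        have "(y has_real_derivative - F (y t)) (at t)"
          using solves_dominating_ODE_derivative[OF sol \<open>T > 0\<close> F_cont, of t] t
          by (simp add: at_within_Icc_at)
        then show "(?g has_real_derivative inverse (1 + (y t)\<^sup>2) * - F (y t) + c) (at t)"
          by (auto intro!: derivative_eq_intros simp: field_simps)
        have "y t \<ge> h"
          using solves_dominating_ODE_ge_terminal[OF sol \<open>T > 0\<close> F_cont \<open>F h > 0\<close>] t by auto
        moreover have "1 + (y t)\<^sup>2 > 0" by (simp add: add_pos_nonneg)
        ultimately show "inverse (1 + (y t)\<^sup>2) * - F (y t) + c \<le> 0"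
          using c(2)[of "y t"] by (simp add: field_simps)
      qed
      show "continuous_on {0..T} ?g"
        by (intro continuous_intros solves_dominating_ODE_continuous_on[OF sol \<open>T > 0\<close>])
    qed (use \<open>T > 0\<close> in simp)
    moreover have "c * T = pi" using c by (simp add: T_def)
    ultimately show False
      using arctan_bounded[of "y T"] arctan_bounded[of "y 0"] by simp
  qed
  with \<open>T > 0\<close> that show thesis by blast
qed

section \<open>The equivalence, by the sign of \<open>F h\<close>\<close>

theorem theorem5p3:
  fixes b1 b2 b3 \<sigma>1 \<sigma>2 f1 f2 f3 h :: real
  fixes F :: "real \<Rightarrow> real"
  defines "F \<equiv> dominating_F b1 b2 b3 \<sigma>1 \<sigma>2 f1 f2 f3"
  shows "(\<forall>T>0. \<exists>y. solves_dominating_ODE F h T y \<and> bounded (y ` {0..T})) \<longleftrightarrow>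
         (F h \<ge> 0 \<and> (\<exists>z\<in>{h..}. F z = 0)) \<or>
         (F h \<le> 0 \<and> (\<exists>z\<in>{..h}. F z = 0)) \<or>
         (\<sigma>2 * b3 = 0 \<and> b2 + f3 * \<sigma>2 + b3 * \<sigma>1 = 0)"
    (is "?solvable \<longleftrightarrow> ?up \<or> ?down \<or> ?affine")
proof -
  define a1 a2 a3 where "a1 = f2 + b1 + \<sigma>1 * f3" "a2 = b2 + f3 * \<sigma>2 + b3 * \<sigma>1" "a3 = \<sigma>2 * b3"
  note a_defs = this
  have F: "F x = f1 + a1 * x + a2 * x\<^sup>2 + a3 * x ^ 3" for x
    by (simp add: F_def dominating_F_def a_defs)
  \<comment> \<open>The reflected field is again a cubic; only the even coefficients change sign, so
    being affine is preserved.\<close>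
  have G: "- F (- x) = - f1 + a1 * x + - a2 * x\<^sup>2 + a3 * x ^ 3" for x
    by (simp add: F)
  show ?thesis
  proof
    assume solvable: ?solvable
    show "?up \<or> ?down \<or> ?affine"
    proof (rule ccontr)
      assume contra: "\<not> (?up \<or> ?down \<or> ?affine)"
      then have nonaffine: "\<not> (a3 = 0 \<and> a2 = 0)" by (simp add: a_defs)
      \<comment> \<open>If \<open>F h = 0\<close>, then \<open>h\<close> itself is a zero witnessing
        the first case.\<close>
      consider "F h > 0" | "F h < 0" using contra by fastforce
      then show False
      proof cases
        case 1
        with contra have "F x \<noteq> 0" if "x \<ge> h" for x using that by force
        then obtain T where "T > 0" "\<And>y. \<not> solves_dominating_ODE F h T y"
          using not_solvable_if_no_zero_above[of F, OF F 1 _ nonaffine] by metis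
        with solvable show False by blast
      next
        case 2
        have "- F (- x) \<noteq> 0" if "x \<ge> - h" for x
          using that contra 2 by (auto dest: bspec[of _ _ "- x"])
        then obtain T where "T > 0" "\<And>y. \<not> solves_dominating_ODE (\<lambda>x. - F (- x)) (- h) T y"
          using not_solvable_if_no_zero_above[of "\<lambda>x. - F (- x)", OF G, of "- h"] 2 nonaffine by auto
        with solvable show False
          using solvable_reflect_iff[of F h T] by blast
      qed
    qed
  next
    assume "?up \<or> ?down \<or> ?affine"
    then consider ?up | ?down | ?affine by blast
    then show ?solvable
    proof cases
      case 1
      then show ?thesis using solvable_if_zero_above[of F, OF F] by auto
    next
      case 2
      then obtain z where "z \<le> h" "F z = 0" by auto
      with 2 show ?thesis
        \<comment> \<open>Reflection moves the zero \<open>z\<close> below \<open>h\<close> to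
          \<open>- z\<close> above \<open>- h\<close>.\<close>
        using solvable_if_zero_above[of "\<lambda>x. - F (- x)", OF G, of _ "- h" "- z"]
        by (auto simp: solvable_reflect_iff)
    next
      case 3
      then have "F x = f1 + a1 * x" for x by (simp add: F a_defs)
      then show ?thesis using solvable_if_affine[of F] by blast
    qed
  qed
qed

end
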